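(* Let $X$ be a nonempty set and $\sigma\colon X\times X\to\mathbb{R}_+$ a function. Suppose that: (S) for all $x,y\in X$, $x\neq y$ if and only if $\sigma(x,y)>0$; and (B) $\sup\{\sigma(x,y): x,y\in\bar{B}(z,M)\}<\infty$ for all $z\in X$ and $M>0$. Let $C$ be a nonempty subset of $X$ and $T\colon C\to X$ a mapping such that the fixed point set $\mathrm{F}(T)$ is nonempty. Then the following are equivalent: (1) $T$ is strongly quasinonexpansive with respect to $\sigma$; (2) $T$ is quasinonexpansive with respect to $\sigma$, and for every $z\in\mathrm{F}(T)$, every $M>0$ and every sequence $\{x_n\}$ in $C\cap\bar{B}(z,M)$ with $\sigma(z,x_n)-\sigma(z,Tx_n)\to 0$, one has $\sigma(Tx_n,x_n)\to 0$.
   Context: $\mathbb{R}_+$ is the set of nonnegative real numbers. No symmetry or triangle inequality is assumed for $\sigma$ beyond what is stated. For $z\in X$ and $M>0$, $\bar{B}(z,M)=\{x\in X:\sigma(z,x)\le M\}$. For $C\subset X$ and $T\colon C\to X$, $\mathrm{F}(T)=\{z\in C: z=Tz\}$. $T$ is quasinonexpansive (with respect to $\sigma$) if $\mathrm{F}(T)\neq\emptyset$ and $\sigma(z,Tx)\le\sigma(z,x)$ for all $z\in\mathrm{F}(T)$ and $x\in C$. $T$ is strongly quasinonexpansive (with respect to $\sigma$) if $\mathrm{F}(T)\neq\emptyset$ and for any $z\in\mathrm{F}(T)$, $M>0$ and $\epsilon>0$ there exists $\delta>0$ such that $x\in C\cap\bar{B}(z,M)$ and $\sigma(z,x)-\sigma(z,Tx)<\delta$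 imply $\sigma(Tx,x)<\epsilon$. *)

theory Defs
  imports Complex_Main "HOL-Library.Extended_Real"
begin

(* A carrier set X inside a type, with a function sigma whose values matter only on X.
   No symmetry and no triangle inequality: the order of the arguments of sigma is significant. *)

definition sball :: "'a set \<Rightarrow> ('a \<Rightarrow> 'a \<Rightarrow> real) \<Rightarrow> 'a \<Rightarrow> real \<Rightarrow> 'a set" where
  "sball X \<sigma> z M = {x \<in> X. \<sigma> z x \<le> M}"

definition Fix :: "'a set \<Rightarrow> ('a \<Rightarrow> 'a) \<Rightarrow> 'a set" where
  "Fix C T = {z \<in> C. z = T z}"

definition quasinonexpansive :: "('a \<Rightarrow> 'a \<Rightarrow> real) \<Rightarrow> 'a set \<Rightarrow> ('a \<Rightarrow> 'a) \<Rightarrow> bool" where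
  "quasinonexpansive \<sigma> C T \<longleftrightarrow>
     Fix C T \<noteq> {} \<and> (\<forall>z \<in> Fix C T. \<forall>x \<in> C. \<sigma> z (T x) \<le> \<sigma> z x)"

definition strongly_quasinonexpansive ::
  "'a set \<Rightarrow> ('a \<Rightarrow> 'a \<Rightarrow> real) \<Rightarrow> 'a set \<Rightarrow> ('a \<Rightarrow> 'a) \<Rightarrow> bool" where
  "strongly_quasinonexpansive X \<sigma> C T \<longleftrightarrow>
     Fix C T \<noteq> {} \<and>
     (\<forall>z \<in> Fix C T. \<forall>M > 0. \<forall>\<epsilon> > 0. \<exists>\<delta> > 0.
        \<forall>x \<in> C \<inter> sball X \<sigma> z M. \<sigma> z x - \<sigma> z (T x) < \<delta> \<longrightarrow> \<sigma> (T x) x < \<epsilon>)"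

end

theory Submission
  imports Defs
begin

text \<open>Fix \<open>z\<close> and \<open>M\<close> and call
  \<open>\<sigma> z x - \<sigma> z (T x)\<close> the gap at \<open>x\<close>. Strong
  quasinonexpansiveness is a uniform statement on the ball: a small gap forces a small
  \<open>\<sigma> (T x) x\<close>. Its sequential form follows by the usual epsilon-delta argument,
  and the converse by choosing counterexamples for \<delta> = 1/(n+1). The one asymmetry is that the
  uniform form bounds the gap only from above, whereas the sequential form needs it to tend to 0;
  quasinonexpansiveness supplies the lower bound 0. That strong quasinonexpansiveness yields this
  lower bound is the present lemma: a negative gap lies below every \<delta>, so
  \<open>\<sigma> (T x) x\<close> would be below every positive \<epsilon>, hence
  \<open>T x = x\<close> by (S), and the gap would be 0.\<close>

lemma strongly_quasinonexpansive_imp_quasinonexpansive: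
  fixes X C :: "'a set" and \<sigma> :: "'a \<Rightarrow> 'a \<Rightarrow> real" and T :: "'a \<Rightarrow> 'a"
  assumes nonneg: "\<forall>x \<in> X. \<forall>y \<in> X. 0 \<le> \<sigma> x y"
    and S: "\<forall>x \<in> X. \<forall>y \<in> X. x \<noteq> y \<longleftrightarrow> 0 < \<sigma> x y"
    and C: "C \<subseteq> X" and T: "T ` C \<subseteq> X"
    and sqn: "strongly_quasinonexpansive X \<sigma> C T"
  shows "quasinonexpansive \<sigma> C T"
  unfolding quasinonexpansive_def
proof (intro conjI ballI)
  show "Fix C T \<noteq> {}"
    using sqn by (simp add: strongly_quasinonexpansive_def)
next
  fix z x assume z: "z \<in> Fix C T" and x: "x \<in> C"
  have X: "z \<in> X" "x \<in> X" "T x \<in> X"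
    using z x C T by (auto simp: Fix_def)
  show "\<sigma> z (T x) \<le> \<sigma> z x"
  proof (rule ccontr)
    assume less: "\<not> \<sigma> z (T x) \<le> \<sigma> z x"
    then have "T x \<noteq> x" by auto
    then have pos: "\<sigma> (T x) x > 0" using S X by blast
    \<comment> \<open>Any positive radius that captures \<open>x\<close> will do; adding 1 keeps it
      positive even when \<open>\<sigma> z x = 0\<close>.\<close>
    have M: "\<sigma> z x + 1 > 0" using nonneg X by (simp add: add_nonneg_pos)
    \<comment> \<open>Taking \<epsilon> to be \<open>\<sigma> (T x) x\<close> itself makes the
      conclusion at \<open>y = x\<close> absurd.\<close>
    obtain \<delta> where "\<delta> > 0" and
      \<delta>: "\<forall>y \<in> C \<inter> sball X \<sigma> z (\<sigma> z x + 1). \<sigma> z y - \<sigma> z (T y) < \<delta> \<longrightarrow> \<sigma> (T y) y < \<sigma> (T x) x"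
      using sqn z M pos unfolding strongly_quasinonexpansive_def by blast
    moreover have "x \<in> C \<inter> sball X \<sigma> z (\<sigma> z x + 1)"
      using x X by (simp add: sball_def)
    ultimately show False using less by force
  qed
qed

theorem theorem4p4:
  fixes X C :: "'a set" and \<sigma> :: "'a \<Rightarrow> 'a \<Rightarrow> real" and T :: "'a \<Rightarrow> 'a"
  assumes "X \<noteq> {}"
    and nonneg: "\<forall>x \<in> X. \<forall>y \<in> X. 0 \<le> \<sigma> x y"
    and S: "\<forall>x \<in> X. \<forall>y \<in> X. x \<noteq> y \<longleftrightarrow> 0 < \<sigma> x y"
    and B: "\<forall>z \<in> X. \<forall>M > 0.
              (SUP (x, y) \<in> sball X \<sigma> z M \<times> sball X \<sigma> z M. ereal (\<sigma> x y)) < \<infinity>"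
    and "C \<noteq> {}" and "C \<subseteq> X"
    and "T ` C \<subseteq> X"
    and "Fix C T \<noteq> {}"
  shows "strongly_quasinonexpansive X \<sigma> C T \<longleftrightarrow>
    quasinonexpansive \<sigma> C T \<and>
    (\<forall>z \<in> Fix C T. \<forall>M > 0. \<forall>x :: nat \<Rightarrow> 'a.
       (\<forall>n. x n \<in> C \<inter> sball X \<sigma> z M) \<longrightarrow>
       (\<lambda>n. \<sigma> z (x n) - \<sigma> z (T (x n))) \<longlonglongrightarrow> 0 \<longrightarrow>
       (\<lambda>n. \<sigma> (T (x n)) (x n)) \<longlonglongrightarrow> 0)"
proof (intro iffI conjI ballI allI impI)
  assume "strongly_quasinonexpansive X \<sigma> C T"
  then show "quasinonexpansive \<sigma> C T"
    by (intro strongly_quasinonexpansive_imp_quasinonexpansive[OF nonneg S \<open>C \<subseteq> X\<close> \<open>T ` C \<subseteq> X\<close>])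
next
  fix z :: 'a and M :: real and x :: "nat \<Rightarrow> 'a"
  assume sqn: "strongly_quasinonexpansive X \<sigma> C T" and z: "z \<in> Fix C T" and M: "M > 0"
    and x: "\<forall>n. x n \<in> C \<inter> sball X \<sigma> z M"
    and lim: "(\<lambda>n. \<sigma> z (x n) - \<sigma> z (T (x n))) \<longlonglongrightarrow> 0"
  show "(\<lambda>n. \<sigma> (T (x n)) (x n)) \<longlonglongrightarrow> 0"
  \<comment> \<open>Nonnegativity of \<sigma> settles the bounds below 0, so only upper bounds
    require the hypothesis on \<open>T\<close>.\<close>
  proof (rule order_tendstoI)
    fix a :: real assume "a < 0"
    moreover have "0 \<le> \<sigma> (T (x n)) (x n)" for n
      using nonneg x \<open>C \<subseteq> X\<close> \<open>T ` C \<subseteq> X\<close> by blast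
    ultimately show "eventually (\<lambda>n. a < \<sigma> (T (x n)) (x n)) sequentially"
      by (intro always_eventually allI) (rule less_le_trans)
  next
    fix \<epsilon> :: real assume "0 < \<epsilon>"
    then obtain \<delta> where "\<delta> > 0" and
      \<delta>: "\<forall>y \<in> C \<inter> sball X \<sigma> z M. \<sigma> z y - \<sigma> z (T y) < \<delta> \<longrightarrow> \<sigma> (T y) y < \<epsilon>"
      using sqn z M unfolding strongly_quasinonexpansive_def by blast
    have "eventually (\<lambda>n. \<sigma> z (x n) - \<sigma> z (T (x n)) < \<delta>) sequentially"
      using order_tendstoD(2)[OF lim \<open>\<delta> > 0\<close>] .
    then show "eventually (\<lambda>n. \<sigma> (T (x n)) (x n) < \<epsilon>) sequentially"
      using \<delta> x by (auto elim!: eventually_mono)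
  qed
next
  assume R: "quasinonexpansive \<sigma> C T \<and>
    (\<forall>z \<in> Fix C T. \<forall>M > 0. \<forall>x :: nat \<Rightarrow> 'a.
       (\<forall>n. x n \<in> C \<inter> sball X \<sigma> z M) \<longrightarrow>
       (\<lambda>n. \<sigma> z (x n) - \<sigma> z (T (x n))) \<longlonglongrightarrow> 0 \<longrightarrow>
       (\<lambda>n. \<sigma> (T (x n)) (x n)) \<longlonglongrightarrow> 0)"
  show "strongly_quasinonexpansive X \<sigma> C T"
    unfolding strongly_quasinonexpansive_def
  proof (intro conjI ballI allI impI)
    show "Fix C T \<noteq> {}" by fact
  next
    fix z :: 'a and M \<epsilon> :: real
    assume z: "z \<in> Fix C T" and M: "M > 0" and \<epsilon>: "\<epsilon> > 0"
    show "\<exists>\<delta>>0. \<forall>x \<in> C \<inter> sball X \<sigma> z M. \<sigma> z x - \<sigma> z (T x) < \<delta> \<longrightarrow> \<sigma> (T x) x < \<epsilon>"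
    proof (rule ccontr)
      assume no_delta: "\<not> ?thesis"
      \<comment> \<open>Failure of \<delta> = 1/(n+1) gives the n-th counterexample;
        \<open>Suc n\<close> keeps this \<delta> positive at n = 0.\<close>
      have "\<exists>x. x \<in> C \<inter> sball X \<sigma> z M \<and> \<sigma> z x - \<sigma> z (T x) < inverse (real (Suc n))
          \<and> \<epsilon> \<le> \<sigma> (T x) x" for n
      proof -
        have "inverse (real (Suc n)) > 0" by simp
        with no_delta show ?thesis by (meson not_less)
      qed
      then obtain x where x: "\<And>n. x n \<in> C \<inter> sball X \<sigma> z M"
        and upper: "\<And>n. \<sigma> z (x n) - \<sigma> z (T (x n)) < inverse (real (Suc n))"
        and far: "\<And>n. \<epsilon> \<le> \<sigma> (T (x n)) (x n)"
        by metis
      \<comment> \<open>Here quasinonexpansiveness enters: it traps the gap between 0 and 1/(n+1),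
        so the sequential hypothesis applies.\<close>
      have lower: "0 \<le> \<sigma> z (x n) - \<sigma> z (T (x n))" for n
        using R z x[of n] by (simp add: quasinonexpansive_def)
      have "(\<lambda>n. \<sigma> z (x n) - \<sigma> z (T (x n))) \<longlonglongrightarrow> 0"
        by (rule tendsto_sandwich[OF _ _ tendsto_const LIMSEQ_inverse_real_of_nat])
          (intro always_eventually allI lower less_imp_le[OF upper])+
      then have "(\<lambda>n. \<sigma> (T (x n)) (x n)) \<longlonglongrightarrow> 0"
        using R z M x by blast
      \<comment> \<open>A sequence bounded below by \<epsilon> cannot have a limit smaller than
        \<epsilon>.\<close>
      then have "\<epsilon> \<le> 0"
        by (rule LIMSEQ_le_const) (use far in blast)
      with \<epsilon> show False by simp
    qed
  qed
qed

end
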